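(* Assume the Suslin Hypothesis, i.e. that there is no $\aleph_1$-Suslin tree. Then every Suslinian continuum is metrizable.
   Context: A continuum is a compact connected Hausdorff space; it is non-degenerate if it has more than one point. A continuum $X$ is Suslinian if it contains no uncountable family of pairwise disjoint non-degenerate subcontinua. A tree is called $\aleph_1$-Suslin if it has height $\omega_1$ but contains no uncountable chain and no uncountable antichain. *)

theory Defs
  imports "HOL-Analysis.Analysis"
begin

unbundle cardinal_syntax
no_notation (input) elt_set_eq (infix \<open>=o\<close> 50)

definition continuum :: "'a topology \<Rightarrow> bool" where
  "continuum X \<longleftrightarrow> compact_space X \<and> connected_space X \<and> Hausdorff_space X"

definition subcontinuum_of :: "'a set \<Rightarrow> 'a topology \<Rightarrow> bool" where
  "subcontinuum_of K X \<longleftrightarrow> K \<subseteq> topspace X \<and> continuum (subtopology X K)"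

definition nondegenerate :: "'a set \<Rightarrow> bool" where
  "nondegenerate K \<longleftrightarrow> (\<exists>x\<in>K. \<exists>y\<in>K. x \<noteq> y)"

definition Suslinian_continuum :: "'a topology \<Rightarrow> bool" where
  "Suslinian_continuum X \<longleftrightarrow> continuum X \<and>
     \<not> (\<exists>\<F>. uncountable \<F> \<and> pairwise disjnt \<F> \<and>
           (\<forall>K\<in>\<F>. subcontinuum_of K X \<and> nondegenerate K))"

text \<open>
  Partial orders are reflexive relations \<open>r\<close> with carrier \<open>Field r\<close>, and ordinals are
  well-orders up to \<open>=o\<close>, as in the library theories on well-orders.
\<close>

definition tree :: "'a rel \<Rightarrow> bool" where
  "tree r \<longleftrightarrow> Partial_order r \<and> (\<forall>t\<in>Field r. well_order_on (underS r t) (Restr r (underS r t)))"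

definition tree_level :: "'a rel \<Rightarrow> 'b rel \<Rightarrow> 'a set" where
  "tree_level r \<alpha> = {t \<in> Field r. Restr r (underS r t) =o \<alpha>}"

text \<open>
  The height is the least ordinal whose level is empty. Every ordinal below \<open>\<alpha>\<close> is
  isomorphic to a well-order on the type underlying \<open>\<alpha>\<close>, so it suffices to let \<open>\<beta>\<close>
  range over that type.
\<close>

definition tree_has_height :: "'a rel \<Rightarrow> 'b rel \<Rightarrow> bool" where
  "tree_has_height r \<alpha> \<longleftrightarrow> Well_order \<alpha> \<and> tree_level r \<alpha> = {} \<and>
     (\<forall>\<beta>::'b rel. \<beta> <o \<alpha> \<longrightarrow> tree_level r \<beta> \<noteq> {})"

definition antichain_in :: "'a rel \<Rightarrow> 'a set \<Rightarrow> bool" where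
  "antichain_in r A \<longleftrightarrow> A \<subseteq> Field r \<and> (\<forall>a\<in>A. \<forall>b\<in>A. a \<noteq> b \<longrightarrow> (a, b) \<notin> r)"

abbreviation omega1 :: "nat set rel" where
  "omega1 \<equiv> cardSuc natLeq"

definition aleph1_Suslin_tree :: "'a rel \<Rightarrow> bool" where
  "aleph1_Suslin_tree r \<longleftrightarrow> tree r \<and> tree_has_height r omega1 \<and>
     \<not> (\<exists>C. C \<in> Chains r \<and> uncountable C) \<and>
     \<not> (\<exists>A. antichain_in r A \<and> uncountable A)"

text \<open>
  A formula cannot quantify over types. Lemma \<open>aleph1_Suslin_tree_transfer\<close> below shows that
  a Suslin tree on any type has an isomorphic copy on a subset of \<open>nat set\<close>, so nothing is
  lost by looking only at trees on that type.
\<close>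

definition Suslin_Hypothesis :: bool where
  "Suslin_Hypothesis \<longleftrightarrow> \<not> (\<exists>r :: nat set rel. aleph1_Suslin_tree r)"

lemma Well_order_omega1: "Well_order omega1"
  by (metis cardSuc_Card_order card_order_on_well_order_on natLeq_Card_order)

lemma Field_Restr_underS:
  assumes "tree r" shows "Field (Restr r (underS r t)) = underS r t"
proof -
  have "\<And>x. x \<in> underS r t \<Longrightarrow> (x, x) \<in> r"
    using assms
    by (auto simp: tree_def underS_def Field_def partial_order_on_def preorder_on_def
        dest!: refl_onD)
  then show ?thesis by (auto simp: Field_def)
qed

lemma Well_order_predecessors:
  assumes "tree r" "t \<in> Field r" shows "Well_order (Restr r (underS r t))"
  using assms Field_Restr_underS[OF assms(1)] by (auto simp: tree_def)

lemma Restr_predecessors: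
  assumes "tree r" "s \<in> underS r t"
  shows "Restr (Restr r (underS r t)) (underS (Restr r (underS r t)) s) = Restr r (underS r s)"
proof -
  have tr: "trans r" and an: "antisym r"
    using assms by (auto simp: tree_def partial_order_on_def preorder_on_def)
  have "underS (Restr r (underS r t)) s = underS r s"
    using assms(2) tr an by (auto simp: underS_def dest: transD antisymD)
  moreover have "underS r s \<subseteq> underS r t"
    using assms(2) tr an by (auto simp: underS_def dest: transD antisymD)
  ultimately show ?thesis by auto
qed

lemma predecessors_ordLess:
  assumes "tree r" "t \<in> Field r" "s \<in> underS r t"
  shows "Restr r (underS r s) <o Restr r (underS r t)"
  using underS_Restr_ordLess[OF Well_order_predecessors[OF assms(1,2)], of s]
    Restr_predecessors[OF assms(1,3)] assms Field_Restr_underS[OF assms(1)]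
  by (metis empty_iff)

lemma tree_level_antichain:
  assumes "tree r" shows "antichain_in r (tree_level r \<alpha>)"
  unfolding antichain_in_def
proof (intro conjI ballI impI notI)
  fix a b assume ab: "a \<in> tree_level r \<alpha>" "b \<in> tree_level r \<alpha>" "a \<noteq> b" "(a, b) \<in> r"
  then have "Restr r (underS r a) <o Restr r (underS r b)"
    using predecessors_ordLess[OF assms] by (auto simp: tree_level_def underS_def)
  moreover have "Restr r (underS r a) =o Restr r (underS r b)"
    using ab by (auto simp: tree_level_def intro: ordIso_transitive ordIso_symmetric)
  ultimately show False by (metis not_ordLess_ordIso)
qed (auto simp: tree_level_def)

lemma ex_level_below_height:
  assumes "tree r" "tree_has_height r \<alpha>" "t \<in> Field r"
  shows "\<exists>x\<in>Field \<alpha>. t \<in> tree_level r (Restr \<alpha> (underS \<alpha> x))"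
proof -
  let ?o = "Restr r (underS r t)"
  have W: "Well_order ?o" "Well_order \<alpha>"
    using Well_order_predecessors assms by (auto simp: tree_has_height_def)
  have "\<not> \<alpha> \<le>o ?o"
  proof
    assume "\<alpha> \<le>o ?o"
    then consider "\<alpha> =o ?o" | "\<alpha> <o ?o" using ordLeq_iff_ordLess_or_ordIso by blast
    then show False
    proof cases
      case 1
      then have "t \<in> tree_level r \<alpha>" using assms(3) by (auto simp: tree_level_def ordIso_symmetric)
      then show False using assms(2) by (auto simp: tree_has_height_def)
    next
      case 2
      then obtain s where s: "s \<in> Field ?o" "\<alpha> =o Restr ?o (underS ?o s)"
        using ordLess_iff_ordIso_Restr[OF W] by blast
      then have su: "s \<in> underS r t" using Field_Restr_underS[OF assms(1)] by metis
      then have "s \<in> Field r" by (auto simp: underS_def Field_def)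
      moreover have "Restr r (underS r s) =o \<alpha>"
        using s(2) Restr_predecessors[OF assms(1) su] by (metis ordIso_symmetric)
      ultimately have "s \<in> tree_level r \<alpha>" by (auto simp: tree_level_def)
      then show False using assms(2) by (auto simp: tree_has_height_def)
    qed
  qed
  then have "?o <o \<alpha>" using W by (metis ordLess_or_ordLeq)
  then obtain x where "x \<in> Field \<alpha>" "?o =o Restr \<alpha> (underS \<alpha> x)"
    using ordLess_iff_ordIso_Restr[OF W(2,1)] by blast
  then show ?thesis using assms(3) by (auto simp: tree_level_def)
qed

lemma Suslin_tree_inj_nat_set:
  assumes "aleph1_Suslin_tree (r :: 'a rel)"
  shows "\<exists>f :: 'a \<Rightarrow> nat set. inj_on f (Field r)"
proof -
  have T: "tree r" "tree_has_height r omega1" using assms by (auto simp: aleph1_Suslin_tree_def)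
  define L where "L x = tree_level r (Restr omega1 (underS omega1 x))" for x
  have cL: "countable (L x)" for x
    using assms tree_level_antichain[OF T(1), of "Restr omega1 (underS omega1 x)"]
    by (auto simp only: L_def aleph1_Suslin_tree_def)
  have "\<forall>t\<in>Field r. \<exists>x. t \<in> L x"
    unfolding L_def using ex_level_below_height[OF T] by meson
  then obtain h where h: "\<And>t. t \<in> Field r \<Longrightarrow> t \<in> L (h t)" by metis
  define f where "f t = (\<lambda>n. 2 * n) ` h t \<union> {2 * to_nat_on (L (h t)) t + 1}" for t
  have "inj_on f (Field r)"
  proof (rule inj_onI)
    fix s t assume st: "s \<in> Field r" "t \<in> Field r" "f s = f t"
    have ev: "h u = {n. 2 * n \<in> f u}" for u unfolding f_def by (auto; presburger)
    have od: "{n. 2 * n + 1 \<in> f u} = {to_nat_on (L (h u)) u}" for u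
      unfolding f_def by (auto; presburger)
    have "h s = h t" using ev st(3) by metis
    moreover have "to_nat_on (L (h s)) s = to_nat_on (L (h t)) t"
      using od[of s] od[of t] st(3) by simp
    ultimately show "s = t" using h[OF st(1)] h[OF st(2)] cL by simp
  qed
  then show ?thesis by blast
qed

lemma aleph1_Suslin_tree_dir_image:
  assumes S: "aleph1_Suslin_tree r" and inj: "inj_on f (Field r)"
  shows "aleph1_Suslin_tree (dir_image r f)"
proof -
  let ?q = "dir_image r f"
  have T: "tree r" "tree_has_height r omega1" using S by (auto simp: aleph1_Suslin_tree_def)
  have P: "Partial_order r" using T by (auto simp: tree_def)
  have F: "Field ?q = f ` Field r" by (rule dir_image_Field)
  have mem: "(f a, f b) \<in> ?q \<longleftrightarrow> (a, b) \<in> r" if "a \<in> Field r" "b \<in> Field r" for a b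
    using that inj unfolding dir_image_def inj_on_def Field_def by blast
  have U: "underS ?q (f t) = f ` underS r t" if "t \<in> Field r" for t
  proof -
    have "x \<in> underS ?q (f t) \<longleftrightarrow> x \<in> f ` underS r t" for x
    proof
      assume "x \<in> underS ?q (f t)"
      then have x: "x \<noteq> f t" "(x, f t) \<in> ?q" by (auto simp: underS_def)
      then have "x \<in> f ` Field r" unfolding F[symmetric] by (rule_tac FieldI1)
      then obtain a where a: "a \<in> Field r" "x = f a" "f a \<noteq> f t" "(f a, f t) \<in> ?q"
        using x by auto
      then show "x \<in> f ` underS r t" using mem[OF a(1) that] by (auto simp: underS_def)
    next
      assume "x \<in> f ` underS r t"
      then obtain a where a: "x = f a" "a \<noteq> t" "(a, t) \<in> r" by (auto simp: underS_def)
      then have "a \<in> Field r" by (auto simp: Field_def)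
      then show "x \<in> underS ?q (f t)"
        using a mem[OF _ that] inj that by (auto simp: underS_def inj_on_def)
    qed
    then show ?thesis by blast
  qed
  have R: "Restr ?q (f ` B) = dir_image (Restr r B) f" if "B \<subseteq> Field r" for B
  proof -
    have "(x, y) \<in> dir_image (Restr r B) f" if xy: "(x, y) \<in> Restr ?q (f ` B)" for x y
    proof -
      obtain a b where ab: "a \<in> B" "b \<in> B" "x = f a" "y = f b" "(f a, f b) \<in> ?q"
        using xy by auto
      then have "(a, b) \<in> r" using mem[of a b] \<open>B \<subseteq> Field r\<close> by (meson subsetD)
      then show ?thesis using ab unfolding dir_image_def by auto
    qed
    moreover have "dir_image (Restr r B) f \<subseteq> Restr ?q (f ` B)" by (auto simp: dir_image_def)
    ultimately show ?thesis by auto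
  qed
  have uF: "underS r t \<subseteq> Field r" for t by (auto simp: underS_def Field_def)
  have RU: "Restr ?q (underS ?q (f t)) = dir_image (Restr r (underS r t)) f" if "t \<in> Field r" for t
    using U[OF that] R[OF uF] by simp
  have injR: "inj_on f (Field (Restr r (underS r t)))" for t
    using inj uF Field_Restr_underS[OF T(1)] by (metis inj_on_subset)
  have iso: "Restr r (underS r t) =o Restr ?q (underS ?q (f t))" if "t \<in> Field r" for t
    using dir_image_ordIso[OF Well_order_predecessors[OF T(1) that] injR] RU[OF that] by simp
  have "tree ?q"
    unfolding tree_def
  proof (intro conjI ballI)
    show "Partial_order ?q" by (rule Partial_order_dir_image[OF P inj])
    fix u assume "u \<in> Field ?q"
    then obtain t where t: "t \<in> Field r" "u = f t" using F by auto
    have "Well_order (Restr ?q (underS ?q u))"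
      using Well_order_dir_image[OF Well_order_predecessors[OF T(1) t(1)] injR] RU t by simp
    moreover have "Field (Restr ?q (underS ?q u)) = underS ?q u"
      using RU[OF t(1)] t(2) U[OF t(1)] Field_Restr_underS[OF T(1)] by (simp add: dir_image_Field)
    ultimately show "well_order_on (underS ?q u) (Restr ?q (underS ?q u))" by simp
  qed
  moreover have lev: "tree_level ?q \<beta> = f ` tree_level r \<beta>" for \<beta> :: "nat set rel"
  proof -
    have "f t \<in> tree_level ?q \<beta> \<longleftrightarrow> t \<in> tree_level r \<beta>" if "t \<in> Field r" for t
      using iso[OF that] that F
      by (auto simp: tree_level_def intro: ordIso_transitive ordIso_symmetric)
    moreover have "tree_level ?q \<beta> \<subseteq> f ` Field r" "tree_level r \<beta> \<subseteq> Field r"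
      using F by (auto simp: tree_level_def)
    ultimately show ?thesis by blast
  qed
  have "tree_has_height ?q omega1"
    using T(2) unfolding tree_has_height_def lev by auto
  moreover have pull: "\<exists>B \<subseteq> Field r. C = f ` B \<and> (uncountable C \<longrightarrow> uncountable B)"
    if "C \<subseteq> Field ?q" for C
    using that F by (metis countable_image subset_image_iff)
  have "countable C" if C: "C \<in> Chains ?q" for C
  proof (rule ccontr)
    assume unc: "uncountable C"
    have "C \<subseteq> Field ?q" using C by (auto simp: Chains_def Field_def)
    then obtain B where B: "B \<subseteq> Field r" "C = f ` B" "uncountable B" using pull unc by metis
    then have "B \<in> Chains r" using C mem by (auto simp: Chains_def subset_iff)
    then show False using S B by (auto simp: aleph1_Suslin_tree_def)
  qed
  moreover have "countable A" if A: "antichain_in ?q A" for A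
  proof (rule ccontr)
    assume unc: "uncountable A"
    then obtain B where B: "B \<subseteq> Field r" "A = f ` B" "uncountable B"
      using pull A by (metis antichain_in_def)
    have "(a, b) \<notin> r" if "a \<in> B" "b \<in> B" "a \<noteq> b" for a b
    proof -
      have "f a \<noteq> f b" using that B(1) inj by (meson inj_on_def subsetD)
      then show ?thesis using that A B mem by (auto simp: antichain_in_def subset_iff)
    qed
    then have "antichain_in r B" using B(1) by (auto simp: antichain_in_def)
    then show False using S B by (auto simp: aleph1_Suslin_tree_def)
  qed
  ultimately show ?thesis unfolding aleph1_Suslin_tree_def by blast
qed

lemma aleph1_Suslin_tree_transfer:
  assumes "aleph1_Suslin_tree (r :: 'a rel)"
  shows "\<exists>q :: nat set rel. aleph1_Suslin_tree q"
proof -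
  obtain f :: "'a \<Rightarrow> nat set" where "inj_on f (Field r)"
    using Suslin_tree_inj_nat_set[OF assms] ..
  from aleph1_Suslin_tree_dir_image[OF assms this] show ?thesis ..
qed

end

theory Submission
  imports Defs
begin

text \<open>
  A non-metrizable Suslinian continuum \<open>X\<close> yields a Suslin tree of subcontinua, ordered by
  reverse inclusion. To a family \<open>F\<close> of continuous real functions belong the nondegenerate
  components of its joint fibres; they are pairwise disjoint subcontinua, hence countably many.
  Recursion along \<open>\<omega>\<^sub>1\<close> produces the levels: level \<open>a\<close> comes from the family that
  contains, for every subcontinuum \<open>K\<close> of an earlier level, one function that is not constant
  on \<open>K\<close>. Later families are larger, so later levels refine earlier ones, and no
  subcontinuum occurs on two levels. Hence any two members of the tree are nested or disjoint,
  and the members above a given one, being on earlier levels, are well-ordered.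

  No level is empty, because each family is countable: if all components of the joint fibres of
  a countable family were degenerate, then \<open>X\<close> would be metrizable
  (\<open>metrizable_if_countable_light\<close>). In that case let \<open>h\<close> be the joint map into the
  sequence space, and let \<open>B\<close> run through a countable base there. By boundary bumping, the
  components of \<open>h\<inverse>(closure B)\<close> that meet \<open>h\<inverse>(B)\<close> are nondegenerate, so there are only
  countably many of them altogether. Any two points of one fibre of \<open>h\<close> lie in different
  components of this kind as soon as \<open>B\<close> is small, so adding a Urysohn function for each
  disjoint pair gives a countable family that separates the points of \<open>X\<close>.

  The tree is therefore uncountable. An antichain is a disjoint family, hence countable. In a
  chain (\<open>countable_nested_subcontinua\<close>) each member \<open>K\<close> but the last has a next smaller
  member \<open>N\<close>, and boundary bumping gives a nondegenerate subcontinuum inside \<open>K - N\<close>;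
  these are pairwise disjoint, so the chain is countable too. An uncountable tree whose chains
  and antichains are countable automatically has height \<open>\<omega>\<^sub>1\<close>.
\<close>

section \<open>Subcontinua\<close>

lemma subcontinuum_of_iff:
  assumes "continuum X"
  shows "subcontinuum_of K X \<longleftrightarrow> closedin X K \<and> connectedin X K"
proof -
  have cH: "compact_space X" "Hausdorff_space X" using assms by (auto simp: continuum_def)
  have "compactin X K \<longleftrightarrow> closedin X K"
    using cH closedin_compact_space compactin_imp_closedin by blast
  then show ?thesis
    using cH Hausdorff_space_subtopology[of X K]
    by (auto simp: subcontinuum_of_def continuum_def connectedin_def compactin_subspace
        dest: closedin_subset)
qed

lemma continuum_imp_normal_space: "continuum X \<Longrightarrow> normal_space X"
  by (simp add: continuum_def compact_Hausdorff_or_regular_imp_normal_space)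

lemma separating_function:
  assumes "continuum X" "x \<in> topspace X" "y \<in> topspace X" "x \<noteq> y"
  shows "\<exists>f. continuous_map X euclideanreal f \<and> f x \<noteq> f y"
proof -
  have "closedin X {x}" "closedin X {y}"
    using assms by (auto simp: continuum_def intro!: closedin_Hausdorff_singleton)
  then obtain f where "continuous_map X euclideanreal f" "f ` {x} \<subseteq> {0::real}" "f ` {y} \<subseteq> {1}"
    using Urysohn_lemma_alt[OF continuum_imp_normal_space[OF assms(1)], of "{x}" "{y}" 0 1] assms(4)
    by (auto simp: disjnt_def)
  then show ?thesis by (auto intro!: exI[of _ f])
qed

text \<open>
  This is boundary bumping in the form in which the Suslinian property can use it: every
  relatively open piece of a nondegenerate subcontinuum is large enough to contribute a
  nondegenerate subcontinuum to a disjoint family.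
\<close>

lemma small_nondegenerate_subcontinuum:
  assumes X: "continuum X" and K: "subcontinuum_of K X" "nondegenerate K"
    and U: "openin X U" and x: "x \<in> K \<inter> U"
  obtains L where "subcontinuum_of L X" "nondegenerate L" "x \<in> L" "L \<subseteq> K \<inter> U"
proof -
  let ?Y = "subtopology X K"
  have Y: "continuum ?Y" "K \<subseteq> topspace X" using K by (auto simp: subcontinuum_of_def)
  then have tY: "topspace ?Y = K" by auto
  have c: "connected_space ?Y" "locally_compact_space ?Y" "Hausdorff_space ?Y"
    using Y by (auto simp: continuum_def compact_imp_locally_compact_space)
  have ne: "{x} \<noteq> topspace ?Y" unfolding tY using K(2) by (auto simp: nondegenerate_def)
  have o: "openin ?Y (K \<inter> U)" using U by (metis openin_subtopology_Int2)
  obtain D where D: "compactin ?Y D" "connectedin ?Y D" "{x} \<subset> D" "D \<subset> K \<inter> U"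
    using intermediate_continuum_exists[OF c _ _ _ ne o] x tY
    by (auto simp: connectedin_sing compactin_sing)
  have "closedin X D"
    using D(1) X by (auto simp: compactin_subtopology continuum_def intro: compactin_imp_closedin)
  then have "subcontinuum_of D X"
    using D(2) by (simp add: subcontinuum_of_iff[OF X] connectedin_subtopology)
  moreover have "nondegenerate D" using D(3) by (auto simp: nondegenerate_def)
  ultimately show thesis using that D(3,4) by blast
qed

lemma Suslinian_countable_disjoint:
  assumes "Suslinian_continuum X" "pairwise disjnt \<F>"
    and "\<And>K. K \<in> \<F> \<Longrightarrow> subcontinuum_of K X \<and> nondegenerate K"
  shows "countable \<F>"
  using assms unfolding Suslinian_continuum_def by blast


section \<open>Components of the fibres of a family of functions\<close>

text \<open>
  For \<open>x \<in> topspace X\<close> this is the component of \<open>x\<close> in its fibre under the map \<open>X \<rightarrow> \<real>^F\<close>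
  with coordinates \<open>F\<close>. The union of connected sets avoids a subspace topology that would
  change with \<open>x\<close> and \<open>F\<close>.
\<close>

definition fibre_component :: "'a topology \<Rightarrow> ('a \<Rightarrow> real) set \<Rightarrow> 'a \<Rightarrow> 'a set" where
  "fibre_component X F x = \<Union>{K. connectedin X K \<and> x \<in> K \<and> (\<forall>f\<in>F. \<forall>y\<in>K. f y = f x)}"

lemma fibre_component_constant: "f \<in> F \<Longrightarrow> y \<in> fibre_component X F x \<Longrightarrow> f y = f x"
  by (auto simp: fibre_component_def)

lemma fibre_component_maximal:
  "connectedin X K \<Longrightarrow> x \<in> K \<Longrightarrow> (\<And>f y. f \<in> F \<Longrightarrow> y \<in> K \<Longrightarrow> f y = f x) \<Longrightarrow> K \<subseteq> fibre_component X F x"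
  by (auto simp: fibre_component_def)

lemma mem_fibre_component: "x \<in> topspace X \<Longrightarrow> x \<in> fibre_component X F x"
  using fibre_component_maximal[of X "{x}" x F] by (simp add: connectedin_sing)

lemma connectedin_fibre_component: "connectedin X (fibre_component X F x)"
  unfolding fibre_component_def by (rule connectedin_Union) auto

lemma fibre_component_subset_topspace: "fibre_component X F x \<subseteq> topspace X"
  by (rule connectedin_subset_topspace[OF connectedin_fibre_component])

lemma fibre_component_base_in_topspace: "z \<in> fibre_component X F x \<Longrightarrow> x \<in> topspace X"
  unfolding fibre_component_def using connectedin_subset_topspace by fastforce

lemma fibre_component_eq:
  assumes "z \<in> fibre_component X F x"
  shows "fibre_component X F z = fibre_component X F x"
proof
  have x: "x \<in> topspace X" by (rule fibre_component_base_in_topspace[OF assms])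
  have f: "f z = f x" if "f \<in> F" for f using fibre_component_constant[OF that assms] .
  have c: "f y = f z" if "f \<in> F" "y \<in> fibre_component X F x" for f y
    using fibre_component_constant[OF that] f[OF that(1)] by simp
  show *: "fibre_component X F x \<subseteq> fibre_component X F z"
    by (rule fibre_component_maximal[OF connectedin_fibre_component assms c])
  have d: "f y = f x" if "f \<in> F" "y \<in> fibre_component X F z" for f y
    using fibre_component_constant[OF that] f[OF that(1)] by simp
  show "fibre_component X F z \<subseteq> fibre_component X F x"
    by (rule fibre_component_maximal[OF connectedin_fibre_component subsetD[OF * mem_fibre_component[OF x]] d])
qed

lemma fibre_component_antimono:
  "F \<subseteq> G \<Longrightarrow> fibre_component X G x \<subseteq> fibre_component X F x"
  unfolding fibre_component_def by blast

lemma closedin_fibre_component: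
  assumes F: "\<And>f. f \<in> F \<Longrightarrow> continuous_map X euclideanreal f"
  shows "closedin X (fibre_component X F x)"
proof (cases "x \<in> topspace X")
  case True
  let ?C = "fibre_component X F x"
  have sub: "?C \<subseteq> topspace X" by (rule fibre_component_subset_topspace)
  have "f y = f x" if "f \<in> F" "y \<in> X closure_of ?C" for f y
  proof -
    have "closedin X {z \<in> topspace X. f z \<in> {f x}}"
      by (rule closedin_continuous_map_preimage[OF F[OF that(1)]]) simp
    moreover have "?C \<subseteq> {z \<in> topspace X. f z \<in> {f x}}"
      using sub fibre_component_constant[OF that(1)] by blast
    ultimately have "X closure_of ?C \<subseteq> {z \<in> topspace X. f z \<in> {f x}}"
      by (simp add: closure_of_minimal)
    then show ?thesis using that by auto
  qed
  then have "X closure_of ?C \<subseteq> ?C"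
    using closure_of_subset[OF sub] mem_fibre_component[OF True]
    by (intro fibre_component_maximal connectedin_closure_of connectedin_fibre_component) auto
  then show ?thesis using sub closure_of_subset_eq by blast
next
  case False
  then have "fibre_component X F x = {}"
    using fibre_component_base_in_topspace[of _ X F x] by blast
  then show ?thesis by simp
qed

definition nondegenerate_fibre_components ::
    "'a topology \<Rightarrow> ('a \<Rightarrow> real) set \<Rightarrow> 'a set set" where
  "nondegenerate_fibre_components X F =
     {K. \<exists>x\<in>topspace X. K = fibre_component X F x \<and> nondegenerate K}"

lemma nondegenerate_fibre_components_subcontinua:
  assumes "continuum X" "\<And>f. f \<in> F \<Longrightarrow> continuous_map X euclideanreal f"
    and "K \<in> nondegenerate_fibre_components X F"
  shows "subcontinuum_of K X" "nondegenerate K"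
  using assms closedin_fibre_component[of F X] connectedin_fibre_component[of X F]
  by (auto simp: nondegenerate_fibre_components_def subcontinuum_of_iff)

lemma disjoint_nondegenerate_fibre_components:
  "pairwise disjnt (nondegenerate_fibre_components X F)"
proof (rule pairwiseI)
  fix K L
  assume "K \<in> nondegenerate_fibre_components X F" "L \<in> nondegenerate_fibre_components X F" "K \<noteq> L"
  then obtain x y where "K = fibre_component X F x" "L = fibre_component X F y" "K \<noteq> L"
    by (auto simp: nondegenerate_fibre_components_def)
  then show "disjnt K L"
    unfolding disjnt_iff using fibre_component_eq[of _ X F x] fibre_component_eq[of _ X F y] by metis
qed

lemma countable_nondegenerate_fibre_components:
  assumes "Suslinian_continuum X" "\<And>f. f \<in> F \<Longrightarrow> continuous_map X euclideanreal f"
  shows "countable (nondegenerate_fibre_components X F)"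
  using assms nondegenerate_fibre_components_subcontinua[of X F]
  by (intro Suslinian_countable_disjoint disjoint_nondegenerate_fibre_components)
    (auto simp: Suslinian_continuum_def)


section \<open>Totally disconnected fibres over a metrizable space\<close>

lemma joint_map:
  fixes F :: "('a \<Rightarrow> real) set"
  assumes "countable F" "\<And>f. f \<in> F \<Longrightarrow> continuous_map X euclideanreal f"
  obtains h :: "'a \<Rightarrow> nat \<Rightarrow> real"
  where "continuous_map X euclidean h" "\<And>x y. h x = h y \<longleftrightarrow> (\<forall>f\<in>F. f x = f y)"
proof -
  let ?G = "insert (\<lambda>_. 0) F"
  have r: "range (from_nat_into ?G) = ?G" using assms(1) by (intro range_from_nat_into) auto
  define h where "h x = (\<lambda>n. from_nat_into ?G n x)" for x
  have "continuous_map X euclidean h"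
    unfolding euclidean_product_topology[symmetric] continuous_map_componentwise_UNIV h_def
  proof
    fix n
    have "from_nat_into ?G n \<in> ?G" using r by blast
    then show "continuous_map X euclidean (from_nat_into ?G n)" using assms(2) by auto
  qed
  moreover have "h x = h y \<longleftrightarrow> (\<forall>f\<in>F. f x = f y)" for x y
  proof -
    have "h x = h y \<longleftrightarrow> (\<forall>f\<in>range (from_nat_into ?G). f x = f y)"
      by (auto simp: h_def fun_eq_iff)
    then show ?thesis unfolding r by simp
  qed
  ultimately show thesis using that by blast
qed

text \<open>
  The joint map embeds the compact space into a metrizable one.
\<close>

lemma metrizable_if_countable_separating:
  assumes "continuum X" "countable F" "\<And>f. f \<in> F \<Longrightarrow> continuous_map X euclideanreal f"
    and sep: "\<And>x y. x \<in> topspace X \<Longrightarrow> y \<in> topspace X \<Longrightarrow> x \<noteq> y \<Longrightarrow> \<exists>f\<in>F. f x \<noteq> f y"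
  shows "metrizable_space X"
proof -
  obtain h :: "'a \<Rightarrow> nat \<Rightarrow> real"
    where h: "continuous_map X euclidean h" "\<And>x y. h x = h y \<longleftrightarrow> (\<forall>f\<in>F. f x = f y)"
    using joint_map[OF assms(2,3)] by metis
  have "inj_on h (topspace X)" unfolding inj_on_def h(2) using sep by blast
  moreover have "closed_map X euclidean h"
    using assms(1) by (intro T1_Spaces.continuous_imp_closed_map[OF h(1)]) (simp_all add: continuum_def)
  ultimately have "X homeomorphic_space (subtopology euclidean (h ` topspace X))"
    by (intro embedding_map_imp_homeomorphic_space injective_closed_imp_embedding_map h(1))
  then show ?thesis
    by (simp add: homeomorphic_metrizable_space metrizable_space_subtopology metrizable_space_euclidean)
qed

text \<open>
  Components of the compact fibre over \<open>p\<close> are quasi-components, so if no connected part of it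
  joins \<open>x\<close> to \<open>y\<close>, then the fibre splits into two closed pieces around these points. Open
  neighbourhoods of the pieces cover the preimage of a whole neighbourhood of \<open>p\<close>, since \<open>h\<close>
  is a closed map.
\<close>

lemma split_neighbourhood_of_fibre:
  fixes h :: "'a \<Rightarrow> 'b::metric_space"
  assumes X: "continuum X" and h: "continuous_map X euclidean h"
    and xy: "x \<in> topspace X" "y \<in> topspace X" "h x = p" "h y = p"
    and no: "\<And>C. connectedin X C \<Longrightarrow> x \<in> C \<Longrightarrow> y \<in> C \<Longrightarrow> \<exists>z\<in>C. h z \<noteq> p"
  obtains U where "open U" "p \<in> U"
    "\<And>C. connectedin X C \<Longrightarrow> x \<in> C \<Longrightarrow> y \<in> C \<Longrightarrow> \<exists>z\<in>C. h z \<notin> U"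
proof -
  have cH: "compact_space X" "Hausdorff_space X" using X by (auto simp: continuum_def)
  define E where "E = {z \<in> topspace X. h z \<in> {p}}"
  have E: "closedin X E"
    unfolding E_def by (rule closedin_continuous_map_preimage[OF h]) simp
  let ?E = "subtopology X E"
  have tE: "topspace ?E = E" using closedin_subset[OF E] by auto
  have "compact_space ?E" "Hausdorff_space ?E"
    using cH E by (auto simp: closedin_compact_space compact_space_subtopology Hausdorff_space_subtopology)
  moreover have "\<not> connected_component_of ?E x y"
    using no by (force simp: connected_component_of_def connectedin_subtopology E_def)
  ultimately have "\<not> quasi_component_of ?E x y"
    by (metis quasi_eq_connected_component_of)
  then have "separated_between ?E {x} {y}"
    using xy by (simp add: quasi_component_nonseparated tE) (simp add: E_def)
  then obtain A B where AB: "closedin ?E A" "closedin ?E B" "A \<union> B = E" "disjnt A B" "x \<in> A" "y \<in> B"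
    unfolding separated_between_alt tE by auto
  then have "closedin X A" "closedin X B" using E closedin_trans_full by blast+
  then obtain P Q where PQ: "openin X P" "openin X Q" "A \<subseteq> P" "B \<subseteq> Q" "disjnt P Q"
    using continuum_imp_normal_space[OF X] AB(4) unfolding normal_space_def by meson
  let ?R = "topspace X - (P \<union> Q)"
  have "closedin X ?R" using PQ by (intro closedin_diff) auto
  then have "closed (h ` ?R)"
    using T1_Spaces.continuous_imp_closed_map[OF h cH(1) Hausdorff_space_euclidean]
    by (auto simp: closed_map_def)
  then have "open (- (h ` ?R))" by auto
  moreover have "p \<in> - (h ` ?R)" using AB(3) PQ(3,4) by (auto simp: E_def)
  moreover have "\<exists>z\<in>C. h z \<notin> - (h ` ?R)" if C: "connectedin X C" "x \<in> C" "y \<in> C" for C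
  proof (rule ccontr)
    assume "\<not> ?thesis"
    then have "C \<subseteq> P \<union> Q" using connectedin_subset_topspace[OF C(1)] by auto
    then show False
      using connectedinD[OF C(1) PQ(1,2)] PQ(3-5) AB(5,6) C by (auto simp: disjnt_iff)
  qed
  ultimately show thesis by (rule that)
qed

text \<open>
  A component of \<open>V\<close> that meets the open set \<open>U\<close> is nondegenerate by boundary bumping. A
  component of \<open>V\<close> outside \<open>U\<close> may well be a point, and of those there can be uncountably
  many.
\<close>

lemma countable_components_meeting_open:
  assumes S: "Suslinian_continuum X" "nondegenerate (topspace X)"
    and V: "closedin X V" and U: "openin X U" "U \<subseteq> V"
  shows "countable ((\<lambda>z. connected_component_of_set (subtopology X V) z) ` U)"
proof (rule Suslinian_countable_disjoint[OF S(1)])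
  let ?c = "\<lambda>z. connected_component_of_set (subtopology X V) z"
  have X: "continuum X" using S by (auto simp: Suslinian_continuum_def)
  show "pairwise disjnt (?c ` U)"
    by (auto simp: pairwise_def connected_component_of_disjoint connected_component_of_equiv)
  fix K assume "K \<in> ?c ` U"
  then obtain z where z: "z \<in> U" "K = ?c z" by auto
  have "closedin X K"
    using closedin_connected_component_of[of "subtopology X V" z] V z(2) closedin_trans_full by metis
  moreover have "connectedin X K"
    using connectedin_connected_component_of[of "subtopology X V" z] z(2) by (auto simp: connectedin_subtopology)
  moreover have "subcontinuum_of (topspace X) X"
    using X by (simp add: subcontinuum_of_def)
  then obtain L where L: "subcontinuum_of L X" "nondegenerate L" "z \<in> L" "L \<subseteq> topspace X \<inter> U"
    using small_nondegenerate_subcontinuum[OF X _ S(2) U(1)] z(1) openin_subset[OF U(1)] by blast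
  have "L \<subseteq> K"
    unfolding z(2) using L U(2)
    by (intro connected_component_of_maximal)
      (auto simp: connectedin_subtopology subcontinuum_of_iff[OF X])
  then have "nondegenerate K" using L(2) by (auto simp: nondegenerate_def)
  ultimately show "subcontinuum_of K X \<and> nondegenerate K"
    by (simp add: subcontinuum_of_iff[OF X])
qed

text \<open>
  Being light over a metrizable space is in general far from being metrizable; here the
  Suslinian property leaves only countably many components over a countable base, and functions
  that separate those from each other repair the defect of the given family.
\<close>

lemma metrizable_if_countable_light:
  assumes S: "Suslinian_continuum X"
    and F: "countable F" "\<And>f. f \<in> F \<Longrightarrow> continuous_map X euclideanreal f"
    and light: "nondegenerate_fibre_components X F = {}"
  shows "metrizable_space X"
proof (cases "nondegenerate (topspace X)")
  case False
  then show ?thesis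
    using metrizable_if_countable_separating[of X "{}"] S
    by (auto simp: nondegenerate_def Suslinian_continuum_def)
next
  case True
  have X: "continuum X" using S by (auto simp: Suslinian_continuum_def)
  obtain h :: "'a \<Rightarrow> nat \<Rightarrow> real"
    where h: "continuous_map X euclidean h" "\<And>x y. h x = h y \<longleftrightarrow> (\<forall>f\<in>F. f x = f y)"
    using joint_map[OF F] by metis
  obtain \<B> :: "(nat \<Rightarrow> real) set set" where \<B>: "countable \<B>" "topological_basis \<B>"
    using ex_countable_basis by blast
  define V where "V B = {x \<in> topspace X. h x \<in> closure B}" for B
  define W where "W B = {x \<in> topspace X. h x \<in> B}" for B
  define c where "c B z = connected_component_of_set (subtopology X (V B)) z" for B z
  define \<C> where "\<C> = (\<Union>B\<in>\<B>. c B ` W B)"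
  have V: "closedin X (V B)" for B
    unfolding V_def by (rule closedin_continuous_map_preimage[OF h(1)]) simp
  have W: "openin X (W B)" if "B \<in> \<B>" for B
    unfolding W_def
    by (rule openin_continuous_map_preimage[OF h(1)]) (simp add: topological_basis_open[OF \<B>(2) that])
  have WV: "W B \<subseteq> V B" for B
    unfolding W_def V_def using closure_subset[of B] by blast
  have "countable (c B ` W B)" if "B \<in> \<B>" for B
    unfolding c_def by (rule countable_components_meeting_open[OF S True V W[OF that] WV])
  then have "countable \<C>"
    unfolding \<C>_def using \<B>(1) by (rule_tac countable_UN) auto
  have "closedin X (c B z)" for B z
    unfolding c_def by (rule closedin_trans_full[OF closedin_connected_component_of V])
  then have "closedin X C" if "C \<in> \<C>" for C
    using that by (auto simp: \<C>_def)
  then have "\<exists>g. continuous_map X euclideanreal g \<and> g ` C \<subseteq> {0} \<and> g ` D \<subseteq> {1}"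
    if "C \<in> \<C>" "D \<in> \<C>" "disjnt C D" for C D
    using Urysohn_lemma_alt[OF continuum_imp_normal_space[OF X]] that by metis
  then obtain g where g: "\<And>C D. C \<in> \<C> \<Longrightarrow> D \<in> \<C> \<Longrightarrow> disjnt C D \<Longrightarrow>
      continuous_map X euclideanreal (g C D) \<and> g C D ` C \<subseteq> {0} \<and> g C D ` D \<subseteq> {1}"
    by metis
  define G where "G = F \<union> (\<lambda>(C, D). g C D) ` {(C, D) \<in> \<C> \<times> \<C>. disjnt C D}"
  have "countable ({(C, D) \<in> \<C> \<times> \<C>. disjnt C D})"
    by (rule countable_subset[of _ "\<C> \<times> \<C>"]) (use \<open>countable \<C>\<close> in auto)
  then have "countable G" using F(1) by (auto simp: G_def)
  moreover have "continuous_map X euclideanreal f" if "f \<in> G" for f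
    using that F(2) g by (auto simp: G_def)
  moreover have "\<exists>f\<in>G. f x \<noteq> f y" if xy: "x \<in> topspace X" "y \<in> topspace X" "x \<noteq> y" for x y
  proof (cases "h x = h y")
    case False
    then show ?thesis using h(2) by (auto simp: G_def)
  next
    case True
    have no: "\<exists>z\<in>C. h z \<noteq> h x" if C: "connectedin X C" "x \<in> C" "y \<in> C" for C
    proof (rule ccontr)
      assume "\<not> ?thesis"
      then have "C \<subseteq> fibre_component X F x"
        using C h(2) by (intro fibre_component_maximal) auto
      then have "nondegenerate (fibre_component X F x)"
        using C xy by (auto simp: nondegenerate_def)
      then show False using light xy(1) by (auto simp: nondegenerate_fibre_components_def)
    qed
    obtain U where U: "open U" "h x \<in> U"
      "\<And>C. connectedin X C \<Longrightarrow> x \<in> C \<Longrightarrow> y \<in> C \<Longrightarrow> \<exists>z\<in>C. h z \<notin> U"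
      using split_neighbourhood_of_fibre[OF X h(1) xy(1,2) refl True[symmetric] no] by blast
    obtain e where e: "e > 0" "cball (h x) e \<subseteq> U" using U(1,2) open_contains_cball by blast
    obtain B where B: "B \<in> \<B>" "h x \<in> B" "B \<subseteq> ball (h x) e"
      by (rule topological_basisE[OF \<B>(2) open_ball, of "h x" "h x" e]) (use e(1) in auto)
    have "closure B \<subseteq> cball (h x) e"
      by (rule closure_minimal[OF order_trans[OF B(3) ball_subset_cball] closed_cball])
    then have cl: "closure B \<subseteq> U" using e(2) by (rule order_trans)
    have inW: "x \<in> W B" "y \<in> W B" using B xy True by (auto simp: W_def)
    then have inC: "c B x \<in> \<C>" "c B y \<in> \<C>" using B(1) by (auto simp: \<C>_def)
    have self: "x \<in> c B x" "y \<in> c B y"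
      using inW WV[of B] xy by (auto simp: c_def connected_component_of_refl)
    \<comment> \<open>\<open>B\<close> is small enough for its preimage to be split between \<open>x\<close> and \<open>y\<close>.\<close>
    have "\<not> connected_component_of (subtopology X (V B)) x y"
    proof
      assume "connected_component_of (subtopology X (V B)) x y"
      then obtain C where C: "connectedin X C" "C \<subseteq> V B" "x \<in> C" "y \<in> C"
        unfolding connected_component_of_def connectedin_subtopology by blast
      show False using U(3)[OF C(1,3,4)] C(2) cl unfolding V_def by blast
    qed
    then have "disjnt (c B x) (c B y)"
      by (simp add: c_def connected_component_of_disjoint)
    then have "g (c B x) (c B y) \<in> G" "g (c B x) (c B y) x = 0" "g (c B x) (c B y) y = 1"
      using g[OF inC] inC self by (auto simp: G_def)
    then show ?thesis by (intro bexI[of _ "g (c B x) (c B y)"]) simp_all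
  qed
  ultimately show ?thesis by (rule metrizable_if_countable_separating[OF X])
qed


section \<open>Recognising Suslin trees\<close>

lemma countable_iff_card_of_ordLeq_natLeq: "countable A \<longleftrightarrow> |A| \<le>o natLeq"
proof -
  have "countable A \<longleftrightarrow> |A| \<le>o |UNIV :: nat set|"
    by (simp add: countable_def card_of_ordLeq[symmetric])
  then show ?thesis
    using card_of_nat by (meson ordIso_symmetric ordLeq_ordIso_trans)
qed

lemma countable_iff_card_of_ordLess_omega1: "countable A \<longleftrightarrow> |A| <o omega1"
  unfolding countable_iff_card_of_ordLeq_natLeq
  using cardSuc_ordLeq_ordLess[OF natLeq_Card_order card_of_Card_order] by blast

lemma Card_order_omega1: "Card_order omega1"
  by (rule cardSuc_Card_order[OF natLeq_Card_order])

lemma countable_underS_omega1: "a \<in> Field omega1 \<Longrightarrow> countable (underS omega1 a)"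
  unfolding countable_iff_card_of_ordLess_omega1 by (rule card_of_underS[OF Card_order_omega1])

lemma uncountable_Field_omega1: "uncountable (Field omega1)"
  unfolding countable_iff_card_of_ordLess_omega1
  using card_of_Field_ordIso[OF Card_order_omega1] not_ordLess_ordIso by blast

lemma countable_Field_below_omega1: "\<beta> <o omega1 \<Longrightarrow> countable (Field \<beta>)"
  unfolding countable_iff_card_of_ordLess_omega1
  by (rule ordLeq_ordLess_trans[OF card_of_least]) (auto simp: ordLess_def)

text \<open>
  Predecessors form a chain, so they are countable and level \<open>\<omega>\<^sub>1\<close> is empty. If an earlier
  level were empty, the tree would be a union of countably many levels, each of them an
  antichain and therefore countable.
\<close>

lemma aleph1_Suslin_tree_if_uncountable:
  assumes tr: "tree r" and unc: "uncountable (Field r)"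
    and chain: "\<And>C. C \<in> Chains r \<Longrightarrow> countable C"
    and anti: "\<And>A. antichain_in r A \<Longrightarrow> countable A"
  shows "aleph1_Suslin_tree r"
proof -
  have "tree_level r omega1 = {}"
  proof (rule ccontr)
    assume "\<not> ?thesis"
    then obtain t where t: "t \<in> Field r" "Restr r (underS r t) =o omega1"
      by (auto simp: tree_level_def)
    then have "|underS r t| =o |Field omega1|"
      using card_of_cong[OF t(2)] Field_Restr_underS[OF tr] by simp
    then have "uncountable (underS r t)"
      using uncountable_Field_omega1 ordIso_ordLeq_trans[OF ordIso_symmetric, of "|underS r t|"]
      unfolding countable_iff_card_of_ordLeq_natLeq by blast
    moreover have "linear_order_on (underS r t) (Restr r (underS r t))"
      using tr t(1) by (auto simp: tree_def well_order_on_def)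
    then have "total_on (underS r t) (Restr r (underS r t))" "refl_on (underS r t) (Restr r (underS r t))"
      by (auto simp: order_on_defs)
    then have "(a, b) \<in> r \<or> (b, a) \<in> r" if "a \<in> underS r t" "b \<in> underS r t" for a b
      using that unfolding total_on_def refl_on_def by (cases "a = b") blast+
    then have "underS r t \<in> Chains r" by (simp add: Chains_def)
    ultimately show False using chain by blast
  qed
  moreover have "\<alpha> <o omega1 \<longrightarrow> tree_level r \<alpha> \<noteq> {}" for \<alpha> :: "nat set rel"
  proof (induction \<alpha> rule: wf_induct_rule[OF wf_ordLess])
    case (1 \<alpha>)
    show ?case
    proof (intro impI notI)
      assume \<alpha>: "\<alpha> <o omega1" "tree_level r \<alpha> = {}"
      \<comment> \<open>By induction \<open>\<alpha>\<close> is the first empty level, so it is the height.\<close>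
      have "tree_level r \<gamma> \<noteq> {}" if "\<gamma> <o \<alpha>" for \<gamma> :: "nat set rel"
        using 1[OF that] ordLess_transitive[OF that \<alpha>(1)] by simp
      then have "tree_has_height r \<alpha>"
        using \<alpha> by (auto simp: tree_has_height_def ordLess_def)
      then have "Field r \<subseteq> (\<Union>x\<in>Field \<alpha>. tree_level r (Restr \<alpha> (underS \<alpha> x)))"
        using ex_level_below_height[OF tr] by (intro subsetI) simp
      moreover have "countable (\<Union>x\<in>Field \<alpha>. tree_level r (Restr \<alpha> (underS \<alpha> x)))"
        using countable_Field_below_omega1[OF \<alpha>(1)] anti[OF tree_level_antichain[OF tr]]
        by (rule countable_UN)
      ultimately have "countable (Field r)" by (rule countable_subset)
      with unc show False ..
    qed
  qed
  ultimately have "tree_has_height r omega1"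
    unfolding tree_has_height_def using Well_order_omega1 by blast
  then show ?thesis using tr chain anti unfolding aleph1_Suslin_tree_def by blast
qed

definition reverse_inclusion_on :: "'a set set \<Rightarrow> 'a set rel" where
  "reverse_inclusion_on T = {(L, K). L \<in> T \<and> K \<in> T \<and> K \<subseteq> L}"

lemma Field_reverse_inclusion_on [simp]: "Field (reverse_inclusion_on T) = T"
  by (auto simp: reverse_inclusion_on_def Field_def)

lemma tree_reverse_inclusion_on:
  assumes ne: "{} \<notin> T"
    and lam: "\<And>K L. K \<in> T \<Longrightarrow> L \<in> T \<Longrightarrow> K \<subseteq> L \<or> L \<subseteq> K \<or> disjnt K L"
    and wf: "wf {(L, K). L \<in> T \<and> K \<in> T \<and> K \<subset> L}"
  shows "tree (reverse_inclusion_on T)"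
proof -
  let ?r = "reverse_inclusion_on T"
  have "Partial_order ?r"
    unfolding order_on_defs Field_reverse_inclusion_on
    by (auto simp: reverse_inclusion_on_def refl_on_def trans_def antisym_def)
  moreover have "well_order_on (underS ?r t) (Restr ?r (underS ?r t))" if t: "t \<in> T" for t
  proof -
    have U: "underS ?r t = {L \<in> T. t \<subset> L}" using t by (auto simp: underS_def reverse_inclusion_on_def)
    have "K \<subseteq> L \<or> L \<subseteq> K" if "K \<in> T" "L \<in> T" "t \<subset> K" "t \<subset> L" for K L
    proof -
      obtain x where "x \<in> t" using ne t by (metis equals0I)
      then show ?thesis using lam[OF that(1,2)] that(3,4) by (auto simp: disjnt_iff)
    qed
    then have "linear_order_on (underS ?r t) (Restr ?r (underS ?r t))"
      unfolding order_on_defs U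
      by (auto simp: reverse_inclusion_on_def refl_on_def trans_def antisym_def total_on_def)
    moreover have "wf (Restr ?r (underS ?r t) - Id)"
      by (rule wf_subset[OF wf]) (auto simp: reverse_inclusion_on_def)
    ultimately show ?thesis by (simp add: well_order_on_def)
  qed
  ultimately show ?thesis by (simp add: tree_def)
qed

lemma ex_recursion_on_earlier_values:
  assumes "Well_order r"
  shows "\<exists>T :: 'a \<Rightarrow> 'b set. \<forall>a. T a = H (\<Union>b\<in>underS r a. T b)"
proof -
  have wf: "wf (r - Id)" using assms by (simp add: well_order_on_def)
  define T where "T \<equiv> wfrec (r - Id) (\<lambda>T a. H (\<Union>b\<in>underS r a. T b))"
  have "T a = H (\<Union>b\<in>underS r a. T b)" for a
  proof -
    have "T a = H (\<Union>b\<in>underS r a. cut T (r - Id) a b)"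
      using def_wfrec[OF T_def wf] by simp
    also have "(\<Union>b\<in>underS r a. cut T (r - Id) a b) = (\<Union>b\<in>underS r a. T b)"
      by (intro SUP_cong refl cut_apply) (simp add: underS_def)
    finally show ?thesis .
  qed
  then show ?thesis by blast
qed


section \<open>Trees of subcontinua\<close>

text \<open>
  Well-foundedness supplies the next smaller member \<open>N K\<close> of every member \<open>K\<close> that has a
  smaller one. The gaps \<open>K - N K\<close> are pairwise disjoint, and each contains a nondegenerate
  subcontinuum.
\<close>

lemma countable_nested_subcontinua:
  assumes S: "Suslinian_continuum X"
    and sub: "\<And>K. K \<in> \<C> \<Longrightarrow> subcontinuum_of K X \<and> nondegenerate K"
    and nest: "\<And>K L. K \<in> \<C> \<Longrightarrow> L \<in> \<C> \<Longrightarrow> K \<subseteq> L \<or> L \<subseteq> K"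
    and wf: "wf {(L, K). L \<in> \<C> \<and> K \<in> \<C> \<and> K \<subset> L}"
  shows "countable \<C>"
proof -
  have X: "continuum X" using S by (simp add: Suslinian_continuum_def)
  define \<C>' where "\<C>' = {K \<in> \<C>. \<exists>L\<in>\<C>. L \<subset> K}"
  have "\<exists>N. N \<in> \<C> \<and> N \<subset> K \<and> (\<forall>L\<in>\<C>. L \<subset> K \<longrightarrow> L \<subseteq> N)" if K: "K \<in> \<C>'" for K
  proof -
    obtain L where "L \<in> {L \<in> \<C>. L \<subset> K}" using K by (auto simp: \<C>'_def)
    then obtain N where N: "N \<in> {L \<in> \<C>. L \<subset> K}"
      "\<forall>L. (L, N) \<in> {(L, K). L \<in> \<C> \<and> K \<in> \<C> \<and> K \<subset> L} \<longrightarrow> L \<notin> {L \<in> \<C>. L \<subset> K}"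
      using wf unfolding wf_eq_minimal by meson
    then have "L \<subseteq> N" if "L \<in> \<C>" "L \<subset> K" for L
      using nest[OF that(1), of N] that by auto
    then show ?thesis using N(1) by blast
  qed
  then obtain N where N: "\<And>K. K \<in> \<C>' \<Longrightarrow> N K \<in> \<C> \<and> N K \<subset> K"
    "\<And>K L. K \<in> \<C>' \<Longrightarrow> L \<in> \<C> \<Longrightarrow> L \<subset> K \<Longrightarrow> L \<subseteq> N K"
    by metis
  have "\<exists>D. subcontinuum_of D X \<and> nondegenerate D \<and> D \<subseteq> K - N K" if K: "K \<in> \<C>'" for K
  proof -
    have KC: "K \<in> \<C>" using K by (simp add: \<C>'_def)
    have cl: "closedin X (N K)"
      using sub N(1)[OF K] by (simp add: subcontinuum_of_iff[OF X])
    have KX: "K \<subseteq> topspace X" using sub[OF KC] by (simp add: subcontinuum_of_def)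
    obtain x where x: "x \<in> K \<inter> (topspace X - N K)" using N(1)[OF K] KX by blast
    obtain D where "subcontinuum_of D X" "nondegenerate D" "D \<subseteq> K \<inter> (topspace X - N K)"
      using small_nondegenerate_subcontinuum[OF X _ _ openin_diff[OF openin_topspace cl] x] sub[OF KC]
      by metis
    then show ?thesis by blast
  qed
  then obtain D where D: "\<And>K. K \<in> \<C>' \<Longrightarrow> subcontinuum_of (D K) X \<and> nondegenerate (D K)"
    "\<And>K. K \<in> \<C>' \<Longrightarrow> D K \<subseteq> K - N K"
    by metis
  have less: "disjnt (D K) (D L)" if "K \<in> \<C>'" "L \<in> \<C>'" "L \<subset> K" for K L
  proof -
    have "D L \<subseteq> N K" using N(2)[of K L] D(2)[OF that(2)] that by (auto simp: \<C>'_def)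
    then show ?thesis using D(2)[OF that(1)] by (auto simp: disjnt_iff)
  qed
  have disj: "disjnt (D K) (D L)" if "K \<in> \<C>'" "L \<in> \<C>'" "K \<noteq> L" for K L
  proof -
    have "L \<subset> K \<or> K \<subset> L" using that nest[of K L] by (auto simp: \<C>'_def)
    then show ?thesis using less[of K L] less[of L K] that disjnt_sym by blast
  qed
  have "countable (D ` \<C>')"
    by (rule Suslinian_countable_disjoint[OF S])
      (use D(1) disj in \<open>auto simp: pairwise_def\<close>)
  moreover have "inj_on D \<C>'"
  proof (rule inj_onI)
    fix K L assume KL: "K \<in> \<C>'" "L \<in> \<C>'" "D K = D L"
    have "D K \<noteq> {}" using D(1)[OF KL(1)] by (auto simp: nondegenerate_def)
    then show "K = L" using disj[OF KL(1,2)] KL(3) by (auto simp: disjnt_def)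
  qed
  ultimately have "countable \<C>'" by (rule countable_image_inj_on)
  moreover have "K = L" if "K \<in> \<C> - \<C>'" "L \<in> \<C> - \<C>'" for K L
    using that nest[of K L] by (auto simp: \<C>'_def)
  then have "countable (\<C> - \<C>')"
    by (metis countable_empty countable_insert ex_in_conv insertI1 countable_subset subsetI)
  ultimately have "countable (\<C>' \<union> (\<C> - \<C>'))" by (rule countable_Un)
  then show ?thesis by (rule countable_subset[rotated]) blast
qed

lemma aleph1_Suslin_tree_of_subcontinua:
  assumes S: "Suslinian_continuum X" and unc: "uncountable \<T>"
    and sub: "\<And>K. K \<in> \<T> \<Longrightarrow> subcontinuum_of K X \<and> nondegenerate K"
    and lam: "\<And>K L. K \<in> \<T> \<Longrightarrow> L \<in> \<T> \<Longrightarrow> K \<subseteq> L \<or> L \<subseteq> K \<or> disjnt K L"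
    and wf: "wf {(L, K). L \<in> \<T> \<and> K \<in> \<T> \<and> K \<subset> L}"
  shows "aleph1_Suslin_tree (reverse_inclusion_on \<T>)"
proof (rule aleph1_Suslin_tree_if_uncountable)
  let ?r = "reverse_inclusion_on \<T>"
  have "{} \<notin> \<T>" using sub by (auto simp: nondegenerate_def)
  then show "tree ?r" using lam wf by (rule tree_reverse_inclusion_on)
  show "uncountable (Field ?r)" using unc by simp
  show "countable \<C>" if C: "\<C> \<in> Chains ?r" for \<C>
  proof -
    have CT: "\<C> \<subseteq> \<T>" using C by (auto simp: Chains_def reverse_inclusion_on_def)
    have "wf {(L, K). L \<in> \<C> \<and> K \<in> \<C> \<and> K \<subset> L}"
      by (rule wf_subset[OF wf]) (use CT in auto)
    moreover have "K \<subseteq> L \<or> L \<subseteq> K" if "K \<in> \<C>" "L \<in> \<C>" for K L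
      using C that unfolding Chains_def reverse_inclusion_on_def by blast
    moreover have "subcontinuum_of K X \<and> nondegenerate K" if "K \<in> \<C>" for K
      using CT sub that by blast
    ultimately show ?thesis by (intro countable_nested_subcontinua[OF S])
  qed
  show "countable \<A>" if A: "antichain_in ?r \<A>" for \<A>
  proof (rule Suslinian_countable_disjoint[OF S])
    have AT: "\<A> \<subseteq> \<T>" using A by (simp add: antichain_in_def)
    then show "subcontinuum_of K X \<and> nondegenerate K" if "K \<in> \<A>" for K using that sub by blast
    show "pairwise disjnt \<A>"
    proof (rule pairwiseI)
      fix K L assume KL: "K \<in> \<A>" "L \<in> \<A>" "K \<noteq> L"
      then have "(K, L) \<notin> ?r" "(L, K) \<notin> ?r" using A by (auto simp: antichain_in_def)
      then show "disjnt K L" using lam[of K L] KL AT by (auto simp: reverse_inclusion_on_def)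
    qed
  qed
qed

text \<open>
  In the proof \<open>T a\<close> is level \<open>a\<close> of the tree and \<open>G a\<close> the family whose fibre components
  make it up; \<open>g K\<close> is the function used to break up \<open>K\<close> on all later levels.
\<close>

lemma nonmetrizable_gives_aleph1_Suslin_tree:
  fixes X :: "'a topology"
  assumes S: "Suslinian_continuum X" and nm: "\<not> metrizable_space X"
  shows "\<exists>\<T> :: 'a set set. aleph1_Suslin_tree (reverse_inclusion_on \<T>)"
proof -
  have X: "continuum X" using S by (simp add: Suslinian_continuum_def)
  define \<S> where "\<S> = {K. subcontinuum_of K X \<and> nondegenerate K}"
  have "\<exists>f. continuous_map X euclideanreal f \<and> (\<exists>x\<in>K. \<exists>y\<in>K. f x \<noteq> f y)" if K: "K \<in> \<S>" for K
  proof -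
    have KX: "K \<subseteq> topspace X" using K by (simp add: \<S>_def subcontinuum_of_def)
    obtain x y where xy: "x \<in> K" "y \<in> K" "x \<noteq> y"
      using K unfolding \<S>_def nondegenerate_def by blast
    then obtain f where "continuous_map X euclideanreal f" "f x \<noteq> f y"
      using separating_function[OF X, of x y] KX by blast
    then show ?thesis using xy by blast
  qed
  then obtain g where g: "\<And>K. K \<in> \<S> \<Longrightarrow> continuous_map X euclideanreal (g K)"
    "\<And>K. K \<in> \<S> \<Longrightarrow> \<exists>x\<in>K. \<exists>y\<in>K. g K x \<noteq> g K y"
    by metis
  let ?N = "nondegenerate_fibre_components X"
  obtain T :: "nat set \<Rightarrow> 'a set set"
    where T: "\<And>a. T a = ?N (g ` (\<S> \<inter> (\<Union>b\<in>underS omega1 a. T b)))"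
    using ex_recursion_on_earlier_values[OF Well_order_omega1,
        of "\<lambda>\<U>. ?N (g ` (\<S> \<inter> \<U>))"] by blast
  define G where "G a = g ` (\<S> \<inter> (\<Union>b\<in>underS omega1 a. T b))" for a
  have TG: "T a = ?N (G a)" for a unfolding G_def by (rule T)
  have contG: "continuous_map X euclideanreal f" if "f \<in> G a" for f a
    using that g(1) by (auto simp: G_def)
  have TS: "T a \<subseteq> \<S>" for a
    unfolding TG using nondegenerate_fibre_components_subcontinua[OF X contG] by (auto simp: \<S>_def)
  have ne: "K \<noteq> {}" if "K \<in> T a" for K a
    using that TS by (auto simp: \<S>_def nondegenerate_def)
  \<comment> \<open>The Suslinian property bounds each level, whatever the size of \<open>G a\<close>. As initial segments
    of \<open>\<omega>\<^sub>1\<close> are countable, \<open>G a\<close> is countable as well.\<close>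
  have "countable (T a)" for a
    unfolding TG by (rule countable_nondegenerate_fibre_components[OF S contG])
  then have "countable (\<Union>b\<in>underS omega1 a. T b)" if "a \<in> Field omega1" for a
    by (intro countable_UN countable_underS_omega1 that)
  then have cG: "countable (G a)" if "a \<in> Field omega1" for a
    unfolding G_def using that by (intro countable_image countable_Int2)
  have T_ne: "T a \<noteq> {}" if "a \<in> Field omega1" for a
  proof
    assume "T a = {}"
    then have "?N (G a) = {}" unfolding TG .
    have "metrizable_space X" by (rule metrizable_if_countable_light[OF S cG[OF that] contG \<open>?N (G a) = {}\<close>])
    with nm show False ..
  qed
  have po: "trans omega1" "antisym omega1" "total_on (Field omega1) omega1" "wf (omega1 - Id)"
    using Well_order_omega1 by (simp_all only: well_order_on_def order_on_defs)
  have refine: "K \<subset> L \<or> disjnt K L" if b: "b \<in> underS omega1 a" and K: "K \<in> T a" and L: "L \<in> T b"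
    for a b K L
  proof -
    have "underS omega1 b \<subseteq> underS omega1 a"
      using b po(1,2) unfolding underS_def trans_def antisym_def by blast
    then have GG: "G b \<subseteq> G a" unfolding G_def by blast
    obtain x where x: "K = fibre_component X (G a) x"
      using K unfolding TG nondegenerate_fibre_components_def by blast
    obtain y where y: "L = fibre_component X (G b) y"
      using L unfolding TG nondegenerate_fibre_components_def by blast
    have LS: "L \<in> \<S>" using L TS by blast
    then have "g L \<in> G a" using L b unfolding G_def by blast
    then have "g L u = g L v" if "u \<in> K" "v \<in> K" for u v
      using that fibre_component_constant[of "g L" "G a" _ X x] unfolding x by metis
    then have "K \<noteq> L" using g(2)[OF LS] by blast
    moreover have "K \<subseteq> L" if z: "z \<in> K" "z \<in> L" for z
    proof -
      have "K = fibre_component X (G a) z" using fibre_component_eq z(1) unfolding x by metis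
      moreover have "L = fibre_component X (G b) z" using fibre_component_eq z(2) unfolding y by metis
      ultimately show ?thesis using fibre_component_antimono[OF GG] by metis
    qed
    ultimately show ?thesis unfolding disjnt_iff by blast
  qed
  have same: "K = L \<or> disjnt K L" if "K \<in> T a" "L \<in> T a" for a K L
    using that disjoint_nondegenerate_fibre_components[of X "G a"] unfolding TG pairwise_def by blast
  have cmp: "a = b \<or> a \<in> underS omega1 b \<or> b \<in> underS omega1 a"
    if "a \<in> Field omega1" "b \<in> Field omega1" for a b
    using that po(3) unfolding total_on_def underS_def by blast
  define \<T> where "\<T> = (\<Union>a\<in>Field omega1. T a)"
  have "\<forall>K\<in>\<T>. \<exists>a\<in>Field omega1. K \<in> T a" by (simp add: \<T>_def)
  then obtain rk where rk: "\<And>K. K \<in> \<T> \<Longrightarrow> rk K \<in> Field omega1" "\<And>K. K \<in> \<T> \<Longrightarrow> K \<in> T (rk K)"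
    by metis
  \<comment> \<open>The level number strictly decreases from a member to a larger one, whence
    well-foundedness.\<close>
  have rk_less: "rk L \<in> underS omega1 (rk K)" if "K \<in> \<T>" "L \<in> \<T>" "K \<subset> L" for K L
  proof -
    have nd: "\<not> disjnt K L" using that(3) ne[OF rk(2)[OF that(1)]] by (auto simp: disjnt_iff)
    have "rk K \<noteq> rk L" using same[of K "rk K" L] rk(2) that nd by auto
    moreover have "rk K \<notin> underS omega1 (rk L)"
      using refine[of "rk K" "rk L" L K] rk(2) that nd disjnt_sym by blast
    ultimately show ?thesis using cmp[of "rk K" "rk L"] rk(1) that by blast
  qed
  have "aleph1_Suslin_tree (reverse_inclusion_on \<T>)"
  proof (rule aleph1_Suslin_tree_of_subcontinua[OF S])
    show "uncountable \<T>"
    proof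
      assume c: "countable \<T>"
      define k where "k a = (SOME K. K \<in> T a)" for a
      have k: "k a \<in> T a" if "a \<in> Field omega1" for a
        using T_ne[OF that] by (simp add: k_def some_in_eq)
      have "a = b" if ab: "a \<in> Field omega1" "b \<in> Field omega1" "k a = k b" for a b
      proof -
        have m: "k a \<in> T a" "k a \<in> T b" "k a \<noteq> {}" using k ab ne by metis+
        then have "\<not> disjnt (k a) (k a)" by (simp add: disjnt_def)
        then show ?thesis using cmp[OF ab(1,2)] refine m(1,2) by blast
      qed
      then have "inj_on k (Field omega1)" by (rule inj_onI)
      moreover have "k ` Field omega1 \<subseteq> \<T>" using k by (auto simp: \<T>_def)
      then have "countable (k ` Field omega1)" using c by (rule countable_subset)
      ultimately have "countable (Field omega1)" using countable_image_inj_on by blast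
      then show False using uncountable_Field_omega1 by contradiction
    qed
    show "subcontinuum_of K X \<and> nondegenerate K" if "K \<in> \<T>" for K
      using that TS unfolding \<T>_def \<S>_def by blast
    show "K \<subseteq> L \<or> L \<subseteq> K \<or> disjnt K L" if KL: "K \<in> \<T>" "L \<in> \<T>" for K L
    proof -
      note m = rk(2)[OF KL(1)] rk(2)[OF KL(2)]
      consider "rk K = rk L" | "rk K \<in> underS omega1 (rk L)" | "rk L \<in> underS omega1 (rk K)"
        using cmp rk(1) KL by blast
      then show ?thesis
      proof cases
        case 1
        then show ?thesis using same m by (metis order_refl)
      next
        case 2
        then show ?thesis using refine[OF 2 m(2,1)] disjnt_sym by blast
      next
        case 3
        then show ?thesis using refine[OF 3 m] by blast
      qed
    qed
    have "wf (inv_image (omega1 - Id) rk)" using po(4) by (rule wf_inv_image)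
    then show "wf {(L, K). L \<in> \<T> \<and> K \<in> \<T> \<and> K \<subset> L}"
      by (rule wf_subset) (use rk_less in \<open>fastforce simp: underS_def psubset_eq\<close>)
  qed
  then show ?thesis ..
qed

theorem corollary4:
  fixes X :: "'a topology"
  assumes "Suslin_Hypothesis"
    and "Suslinian_continuum X"
  shows "metrizable_space X"
proof (rule ccontr)
  assume "\<not> metrizable_space X"
  then obtain \<T> :: "'a set set" where "aleph1_Suslin_tree (reverse_inclusion_on \<T>)"
    using nonmetrizable_gives_aleph1_Suslin_tree[OF assms(2)] by blast
  then have "\<exists>q :: nat set rel. aleph1_Suslin_tree q" by (rule aleph1_Suslin_tree_transfer)
  then show False using assms(1) by (simp add: Suslin_Hypothesis_def)
qed

end
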